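(* Let $(\Omega,\mu)$ be a probability space, $1\le p\le\infty$, $1\le q<\infty$, $C>0$, $D>0$, $m\in\mathbb N$. Let $X$ be a set of functions in $L_p(\Omega,\mu)$, and let points $\xi^1,\dots,\xi^m\in\Omega$ and nonnegative weights $\lambda_1,\dots,\lambda_m$ be such that $\lambda_1+\dots+\lambda_m\le C$ and $$\|f\|_p\le D\left(\sum_{j=1}^m\lambda_j|f(\xi^j)|^q\right)^{1/q}\qquad\text{for all } f\in X.$$ Then there exist a positive integer $m_0\le(C^2+1)m$ and points $\xi_0^1,\dots,\xi_0^{m_0}\in\Omega$ (not necessarily distinct) such that $$\|f\|_p\le D\,(C+C^{-1})^{1/q}\left(\frac1{m_0}\sum_{j=1}^{m_0}|f(\xi_0^j)|^q\right)^{1/q}\qquad\text{for all } f\in X.$$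
   Context: Functions are measurable and defined at every point of $\Omega$ (functions differing on a set of measure zero are not identified). $\|f\|_p=\left(\int_\Omega|f|^p\,d\mu\right)^{1/p}$ for $p<\infty$; for $p=\infty$, $L_\infty$ denotes the space of bounded functions and $\|f\|_\infty=\sup_{\omega\in\Omega}|f(\omega)|$. *)

theory Defs
  imports "HOL-Probability.Probability"
begin

text \<open>
  Functions take values in a \<^class>\<open>real_normed_field\<close>, which covers both real- and
  complex-valued functions. They are not identified almost everywhere, and for
  \<open>p = \<infinity>\<close> boundedness and the norm refer to the actual supremum over the underlying
  space, not to the essential supremum.
\<close>

definition Lp_space :: "'a measure \<Rightarrow> ennreal \<Rightarrow> ('a \<Rightarrow> 'b::real_normed_field) set" where
  "Lp_space M p = {f \<in> borel_measurable M.
     if p = \<infinity> then bounded (f ` space M)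
     else integrable M (\<lambda>x. norm (f x) powr enn2real p)}"

definition Lp_norm :: "'a measure \<Rightarrow> ennreal \<Rightarrow> ('a \<Rightarrow> 'b::real_normed_field) \<Rightarrow> real" where
  "Lp_norm M p f =
     (if p = \<infinity> then (SUP x\<in>space M. norm (f x))
      else (LINT x|M. norm (f x) powr enn2real p) powr (1 / enn2real p))"

end

theory Submission
  imports Defs
begin

text \<open>
  Repeat each point $\xi^j$ exactly $n_j = \lfloor C m \lambda_j \rfloor + 1$ times. Then
  $m_0 = \sum n_j \le C^2 m + m$, and the bound $n_j \ge C m \lambda_j \ge \frac{C}{C^2+1} m_0 \lambda_j$
  means that every weight $\lambda_j$ is at most $(C + C^{-1})\, n_j / m_0$.
\<close>

text \<open>Take \<open>n j\<close> labelled copies of each \<open>j\<close>, enumerate this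
  disjoint union from 1, and let \<open>\<sigma>\<close> forget the label: each \<open>j\<close> is
  then hit exactly \<open>n j\<close> times.\<close>

lemma ex_index_map_with_multiplicities:
  fixes A :: "'i set" and n :: "'i \<Rightarrow> nat"
  assumes "finite A"
  shows "\<exists>\<sigma>. (\<forall>k\<in>{1..\<Sum>j\<in>A. n j}. \<sigma> k \<in> A) \<and>
    (\<forall>g :: 'i \<Rightarrow> real. (\<Sum>k=1..\<Sum>j\<in>A. n j. g (\<sigma> k)) = (\<Sum>j\<in>A. real (n j) * g j))"
proof -
  let ?S = "SIGMA j:A. {..<n j}"
  have fin: "finite ?S" and card: "card ?S = (\<Sum>j\<in>A. n j)"
    using assms by auto
  obtain h where h: "bij_betw h {1..\<Sum>j\<in>A. n j} ?S"
    using ex_bij_betw_nat_finite_1[OF fin] card by auto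
  have "fst (h k) \<in> A" if "k \<in> {1..\<Sum>j\<in>A. n j}" for k
    using bij_betwE[OF h] that by force
  moreover have "(\<Sum>k=1..\<Sum>j\<in>A. n j. g (fst (h k))) = (\<Sum>j\<in>A. real (n j) * g j)"
    for g :: "'i \<Rightarrow> real"
  proof -
    have "(\<Sum>k=1..\<Sum>j\<in>A. n j. g (fst (h k))) = (\<Sum>x\<in>?S. g (fst x))"
      by (rule sum.reindex_bij_betw[OF h])
    also have "\<dots> = (\<Sum>j\<in>A. \<Sum>i<n j. g j)"
      using assms by (subst sum.Sigma) (auto intro: sum.cong)
    finally show ?thesis by simp
  qed
  ultimately show ?thesis
    by (intro exI[of _ "\<lambda>k. fst (h k)"]) simp
qed

theorem proposition3p1:
  fixes M :: "'a measure" and p :: ennreal and q C D :: real and m :: nat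
    and X :: "('a \<Rightarrow> 'b::real_normed_field) set"
    and \<xi> :: "nat \<Rightarrow> 'a" and w :: "nat \<Rightarrow> real"
  assumes "prob_space M"
    and "1 \<le> p" and "1 \<le> q" and "C > 0" and "D > 0" and "m \<ge> 1"
    and "X \<subseteq> Lp_space M p"
    and "\<And>j. j \<in> {1..m} \<Longrightarrow> \<xi> j \<in> space M"
    and "\<And>j. j \<in> {1..m} \<Longrightarrow> w j \<ge> 0"
    and "(\<Sum>j=1..m. w j) \<le> C"
    and "\<And>f. f \<in> X \<Longrightarrow>
      Lp_norm M p f \<le> D * (\<Sum>j=1..m. w j * norm (f (\<xi> j)) powr q) powr (1 / q)"
  shows "\<exists>(m0::nat) (\<xi>0 :: nat \<Rightarrow> 'a).
      m0 \<ge> 1 \<and> real m0 \<le> (C\<^sup>2 + 1) * real m \<and>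
      (\<forall>j\<in>{1..m0}. \<xi>0 j \<in> space M) \<and>
      (\<forall>f\<in>X. Lp_norm M p f \<le>
         D * (C + 1 / C) powr (1 / q) *
           (1 / real m0 * (\<Sum>j=1..m0. norm (f (\<xi>0 j)) powr q)) powr (1 / q))"
proof -
  \<comment> \<open>The \<open>+ 1\<close>, in place of a ceiling, keeps every \<open>n j\<close> at
    least 1, so \<open>m0\<close> is positive even if all weights vanish.\<close>
  define n where "n j = nat \<lfloor>C * m * w j\<rfloor> + 1" for j
  define m0 where "m0 = (\<Sum>j=1..m. n j)"
  \<comment> \<open>The sum identity holds for all \<open>g\<close> with one
    \<open>\<sigma>\<close>, so the new points do not depend on \<open>f\<close>.\<close>
  obtain \<sigma> where \<sigma>: "\<And>k. k \<in> {1..m0} \<Longrightarrow> \<sigma> k \<in> {1..m}"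
    and sum_\<sigma>: "\<And>g :: nat \<Rightarrow> real. (\<Sum>k=1..m0. g (\<sigma> k)) = (\<Sum>j=1..m. real (n j) * g j)"
    using ex_index_map_with_multiplicities[of "{1..m}" n] unfolding m0_def by blast
  have n_ge: "C * m * w j \<le> n j" for j
    unfolding n_def by linarith
  have n_le: "n j \<le> C * m * w j + 1" if "j \<in> {1..m}" for j
  proof -
    \<comment> \<open>\<open>nat\<close> sends negative numbers to 0, so the sign matters for this
      upper bound.\<close>
    have "0 \<le> C * m * w j"
      using assms(4) assms(9)[OF that] by simp
    then show ?thesis
      unfolding n_def by linarith
  qed
  have "m = (\<Sum>j=1..m. 1::nat)" by simp
  also have "\<dots> \<le> m0"
    unfolding m0_def by (rule sum_mono) (simp add: n_def)
  finally have m0_pos: "m0 \<ge> 1" using \<open>m \<ge> 1\<close> by simp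
  \<comment> \<open>Rounding costs at most 1 per point, hence \<open>m\<close> in total; the total
    weight \<open>C\<close> times the scale \<open>C * m\<close> gives the rest.\<close>
  have "real m0 \<le> (\<Sum>j=1..m. C * m * w j + 1)"
    unfolding m0_def of_nat_sum by (rule sum_mono) (rule n_le)
  also have "\<dots> = C * m * (\<Sum>j=1..m. w j) + m"
    by (simp add: sum.distrib sum_distrib_left)
  also have "\<dots> \<le> C * m * C + m"
    using assms(4,10) by (intro add_right_mono mult_left_mono) auto
  also have "\<dots> = (C\<^sup>2 + 1) * m"
    by (simp add: power2_eq_square algebra_simps)
  finally have m0_le: "real m0 \<le> (C\<^sup>2 + 1) * m" .
  have w_le: "w j \<le> (C + 1 / C) * (1 / m0 * n j)" if "j \<in> {1..m}" for j
  proof -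
    \<comment> \<open>Scaling \<open>m0_le\<close> by \<open>C * w j\<close> produces
      \<open>C * m * w j\<close>, which \<open>n_ge\<close> bounds by \<open>n j\<close>. Dividing
      by \<open>C * m0\<close> at the end turns \<open>C\<^sup>2 + 1\<close> into
      \<open>C + 1 / C\<close>.\<close>
    have "C * w j * m0 \<le> C * w j * ((C\<^sup>2 + 1) * m)"
      using assms(4) assms(9)[OF that] m0_le by (intro mult_left_mono) auto
    also have "\<dots> = (C\<^sup>2 + 1) * (C * m * w j)" by simp
    also have "\<dots> \<le> (C\<^sup>2 + 1) * n j"
      by (intro mult_left_mono n_ge) auto
    finally show ?thesis
      using assms(4) m0_pos by (simp add: field_simps power2_eq_square)
  qed
  have "Lp_norm M p f \<le> D * (C + 1 / C) powr (1 / q) *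
      (1 / real m0 * (\<Sum>k=1..m0. norm (f (\<xi> (\<sigma> k))) powr q)) powr (1 / q)" if "f \<in> X" for f
  proof -
    let ?g = "\<lambda>j. norm (f (\<xi> j)) powr q"
    have "(\<Sum>j=1..m. w j * ?g j) \<le> (\<Sum>j=1..m. (C + 1 / C) * (1 / m0 * n j) * ?g j)"
      by (intro sum_mono mult_right_mono w_le) auto
    also have "\<dots> = (C + 1 / C) * (1 / m0 * (\<Sum>j=1..m. n j * ?g j))"
      by (simp only: sum_distrib_left mult.assoc)
    also have "\<dots> = (C + 1 / C) * (1 / m0 * (\<Sum>k=1..m0. ?g (\<sigma> k)))"
      by (simp only: sum_\<sigma>[of ?g])
    \<comment> \<open>Nonnegative weights make the smaller base nonnegative, and
      \<open>1 / q\<close> is positive, so taking the power preserves the inequality.\<close>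
    finally have "(\<Sum>j=1..m. w j * ?g j) powr (1 / q)
        \<le> ((C + 1 / C) * (1 / m0 * (\<Sum>k=1..m0. ?g (\<sigma> k)))) powr (1 / q)"
      using assms(3,9) by (intro powr_mono2) (auto intro!: sum_nonneg)
    also have "\<dots> = (C + 1 / C) powr (1 / q) * (1 / m0 * (\<Sum>k=1..m0. ?g (\<sigma> k))) powr (1 / q)"
      using assms(4) by (intro powr_mult)
    finally show ?thesis
      using assms(11)[OF that] \<open>D > 0\<close> by (smt (verit) mult.assoc mult_left_mono)
  qed
  then show ?thesis
    using m0_pos m0_le \<sigma> assms(8) by (intro exI[of _ m0] exI[of _ "\<lambda>k. \<xi> (\<sigma> k)"]) auto
qed

end
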